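(* Let $\Phi:[0,\infty)\to[0,1]$ be a probability distribution function (of a positive waiting time), increasing with $\Phi(0)=0$ and $\Phi(\infty)=1$, and assume that one of the following holds: (A) $\rho:=\int_0^\infty t\,d\Phi(t)<\infty$; in this case put $\beta=1$ and $\lambda=\rho$; (B) there are $0<\beta<1$ and $c>0$ such that $1-\Phi(t)\sim \frac{c}{\beta}\,t^{-\beta}$ as $t\to\infty$; in this case put $\lambda=\dfrac{c\,\pi}{\Gamma(\beta+1)\,\sin(\beta\pi)}$. Let $\widetilde\phi(s)=\int_0^\infty e^{-st}\,d\Phi(t)$ and, for $\tau>0$ and $a>0$, let $$\widetilde\phi_{\tau,a}(s)=\frac{a\,\widetilde\phi(\tau s)}{1-(1-a)\,\widetilde\phi(\tau s)}$$ be the transform obtained by rescaling time with factor $\tau$ and respeeding with factor $a$. Then, choosing $a=\lambda\tau^\beta$, for every fixed $s>0$, $$\lim_{\tau\to 0^+}\widetilde\phi_{\tau,\lambda\tau^\beta}(s)=\frac{1}{1+s^\beta},$$ and the limit is the Laplace transform of the Mittag-Leffler waiting time density $\phi_\beta^{ML}(t)=-\frac{d}{dt}E_\beta(-t^\beta)$.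
   Context: The Mittag-Leffler function is $E_\beta(z)=\sum_{n=0}^\infty \frac{z^n}{\Gamma(1+\beta n)}$. The Laplace transform of a function $g$ on $[0,\infty)$ is $\widetilde g(s)=\int_0^\infty g(t)e^{-st}\,dt$; densities may be generalized functions representing measures, so $\phi=\Phi'$ and $\widetilde\phi(s)=\int_0^\infty e^{-st}d\Phi(t)$. Rescaling and respeeding: rescaling replaces the waiting time $T$ by $\tau T$, giving $\widetilde\phi_\tau(s)=\widetilde\phi(\tau s)$ and the memory function with Laplace transform $\widetilde H_\tau(s)=\frac{1-\widetilde\phi(\tau s)}{s\,\widetilde\phi(\tau s)}$. Respeeding by the factor $a>0$ replaces $\widetilde H_\tau$ by $\widetilde H_{\tau,a}=\widetilde H_\tau/a$, and $\widetilde\phi_{\tau,a}(s)=\frac{1}{1+s\widetilde H_{\tau,a}(s)}$, which equals the expression displayed in the claim. *)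

theory Defs
  imports "HOL-Probability.Probability"
begin

text \<open>
  A probability distribution function of a positive waiting time, i.e. the function
  \<open>t \<mapsto> P(T \<le> t)\<close> on \<open>[0,\<infinity>)\<close>, hence right-continuous. Only the
  values on \<open>[0,\<infinity>)\<close> matter.
\<close>

definition waiting_time_distribution :: "(real \<Rightarrow> real) \<Rightarrow> bool" where
  "waiting_time_distribution \<Phi> \<longleftrightarrow>
     \<Phi> \<in> {0..} \<rightarrow> {0..1} \<and>
     mono_on {0..} \<Phi> \<and>
     (\<forall>t\<ge>0. continuous (at_right t) \<Phi>) \<and>
     \<Phi> 0 = 0 \<and>
     (\<Phi> \<longlongrightarrow> 1) at_top"

text \<open>
  The Lebesgue--Stieltjes measure \<open>d\<Phi>\<close>; since \<open>\<Phi> 0 = 0\<close>, composing with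
  \<open>max 0\<close> extends \<open>\<Phi>\<close> by zero to the negative half-line.
\<close>

definition stieltjes_measure :: "(real \<Rightarrow> real) \<Rightarrow> real measure" where
  "stieltjes_measure \<Phi> = interval_measure (\<lambda>t. \<Phi> (max 0 t))"

lemma
  assumes "waiting_time_distribution \<Phi>"
  shows real_distribution_stieltjes_measure: "real_distribution (stieltjes_measure \<Phi>)"
    and cdf_stieltjes_measure: "cdf (stieltjes_measure \<Phi>) t = \<Phi> (max 0 t)"
proof -
  let ?F = "\<lambda>t. \<Phi> (max 0 t)"
  have mono: "?F x \<le> ?F y" if "x \<le> y" for x y
    using assms that mono_onD[of "{0..}" \<Phi> "max 0 x" "max 0 y"]
    by (simp add: waiting_time_distribution_def)
  have cont: "continuous (at_right a) ?F" for a
  proof (cases "a \<ge> 0")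
    case True
    have "(\<Phi> \<longlongrightarrow> \<Phi> a) (at_right a)"
      using assms True by (auto simp: waiting_time_distribution_def continuous_within)
    moreover have "eventually (\<lambda>x. ?F x = \<Phi> x) (at_right a)"
      using True by (auto simp: eventually_at_right_field intro!: exI[of _ "a + 1"])
    ultimately have "(?F \<longlongrightarrow> \<Phi> a) (at_right a)"
      by (simp add: tendsto_cong)
    then show ?thesis using True by (simp add: continuous_within)
  next
    case False
    have "eventually (\<lambda>x. ?F x = \<Phi> 0) (at_right a)"
      using False by (auto simp: eventually_at_right_field intro!: exI[of _ 0])
    then have "(?F \<longlongrightarrow> \<Phi> 0) (at_right a)" by (rule tendsto_eventually)
    then show ?thesis using False by (simp add: continuous_within)
  qed
  have bot: "(?F \<longlongrightarrow> 0) at_bot"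
  proof (rule tendsto_eventually)
    show "eventually (\<lambda>x. ?F x = 0) at_bot"
      using eventually_le_at_bot[of "0::real"]
    proof eventually_elim
      case (elim x)
      then show ?case using assms by (simp add: waiting_time_distribution_def max_absorb1)
    qed
  qed
  have top: "(?F \<longlongrightarrow> 1) at_top"
  proof -
    have "eventually (\<lambda>x. ?F x = \<Phi> x) at_top"
      using eventually_ge_at_top[of "0::real"] by eventually_elim simp
    moreover have "(\<Phi> \<longlongrightarrow> 1) at_top"
      using assms by (simp add: waiting_time_distribution_def)
    ultimately show ?thesis
      by (simp add: tendsto_cong)
  qed
  show "real_distribution (stieltjes_measure \<Phi>)"
    unfolding stieltjes_measure_def
    by (rule real_distribution_interval_measure[OF mono cont bot top])
  show "cdf (stieltjes_measure \<Phi>) t = ?F t"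
    unfolding stieltjes_measure_def by (simp add: cdf_interval_measure[OF mono cont bot])
qed

definition laplace_stieltjes :: "(real \<Rightarrow> real) \<Rightarrow> real \<Rightarrow> real" where
  "laplace_stieltjes \<Phi> s = (LINT t:{0..}|stieltjes_measure \<Phi>. exp (- (s * t)))"

definition has_laplace_transform :: "(real \<Rightarrow> real) \<Rightarrow> real \<Rightarrow> real \<Rightarrow> bool" where
  "has_laplace_transform g s v \<longleftrightarrow>
     set_integrable lborel {0..} (\<lambda>t. g t * exp (- (s * t))) \<and>
     (LINT t:{0..}|lborel. g t * exp (- (s * t))) = v"

definition rescale :: "real \<Rightarrow> (real \<Rightarrow> real) \<Rightarrow> real \<Rightarrow> real" where
  "rescale \<tau> f s = f (\<tau> * s)"

definition respeed :: "real \<Rightarrow> (real \<Rightarrow> real) \<Rightarrow> real \<Rightarrow> real" where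
  "respeed a f s = a * f s / (1 - (1 - a) * f s)"

text \<open>
  Respeeding divides the transform of the memory function by \<open>a\<close>.
\<close>

lemma respeed_memory:
  fixes f :: "real \<Rightarrow> real" and H :: "real \<Rightarrow> real"
  assumes "H s = (1 - f s) / (s * f s)" "a > 0" "s > 0" "f s \<noteq> 0"
  shows "respeed a f s = 1 / (1 + s * (H s / a))"
proof -
  have "1 + s * (H s / a) = (1 - (1 - a) * f s) / (a * f s)"
    unfolding assms(1) using assms(2-4) by (simp add: field_simps)
  then show ?thesis by (simp add: respeed_def)
qed

definition mittag_leffler :: "real \<Rightarrow> 'a::real_normed_field \<Rightarrow> 'a" where
  "mittag_leffler \<beta> z = (\<Sum>n. z ^ n / of_real (Gamma (1 + \<beta> * real n)))"

definition mittag_leffler_density :: "real \<Rightarrow> real \<Rightarrow> real" where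
  "mittag_leffler_density \<beta> t = - deriv (\<lambda>u. mittag_leffler \<beta> (- (u powr \<beta>))) t"

end

theory Submission
  imports Defs "HOL-Real_Asymp.Real_Asymp"
begin

text \<open>
  With \<open>f\<close> the Laplace--Stieltjes transform of \<open>\<Phi>\<close>, the respeeded transform with \<open>a = lam * \<tau> powr \<beta>\<close> is
  \<open>1 / (1 + (1 - f (\<tau> * s)) / (a * f (\<tau> * s)))\<close>. So the limit only requires the behaviour of \<open>f\<close> at the
  origin: \<open>f s \<longrightarrow> 1\<close> and \<open>(1 - f s) / s powr \<beta> \<longrightarrow> lam\<close> (lemma \<open>respeed_rescale_tendsto\<close>).
  For a finite mean (and \<open>\<beta> = 1\<close>), the quotient is the expectation of \<open>(1 - exp (- (s * T))) / s\<close>, which is dominated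
  by \<open>T\<close> and tends to \<open>T\<close>. For a power tail, Fubini turns \<open>1 - f s\<close> into the integral of
  \<open>exp (- y) * (1 - \<Phi> (y / s))\<close> over \<open>y > 0\<close>. Divided by \<open>s powr \<beta>\<close> the integrand is
  dominated by a multiple of \<open>y powr (- \<beta>) * exp (- y)\<close> and converges to
  \<open>c / \<beta> * y powr (- \<beta>) * exp (- y)\<close>. This gives the limit \<open>c / \<beta> * Gamma (1 - \<beta>)\<close>, which
  is \<open>lam\<close> by Euler's reflection formula.

  The Mittag-Leffler density \<open>g\<close> is the alternating sum of the Riemann--Liouville kernels \<open>k\<^sub>\<beta>, k\<^sub>2\<^sub>\<beta>, \<dots>\<close>,
  where \<open>k\<^sub>a t = t powr (a - 1) / Gamma a\<close> is the function with transform \<open>s powr (- a)\<close>. Integrating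
  the series term by term against \<open>exp (- (s * t))\<close> is legitimate only for \<open>s > 1\<close>. For all
  \<open>s > 0\<close> at once one uses instead the renewal equation: as the kernels form a convolution semigroup
  (lemma \<open>riemann_liouville_convolution\<close>), \<open>k\<^sub>\<beta> = g + k\<^sub>\<beta> * g\<close> with \<open>*\<close> denoting convolution
  (lemma \<open>relaxation_density_renewal\<close>). If \<open>g \<ge> 0\<close>, all terms are nonnegative and Tonelli's theorem
  yields \<open>s powr (- \<beta>) = G + s powr (- \<beta>) * G\<close> for the transform \<open>G\<close> of \<open>g\<close>, first in
  \<open>[0,\<infinity>]\<close>; as the left-hand side is finite, so is \<open>G\<close>, and \<open>G = 1 / (1 + s powr \<beta>)\<close>.

  The positivity of \<open>g\<close> (lemma \<open>relaxation_density_pos\<close>) is where \<open>\<beta> \<le> 1\<close> enters. It is an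
  instance of a principle for Volterra equations: resolvents of decreasing, log-convex Volterra kernels are positive, and the
  kernel \<open>k\<^sub>\<beta>\<close> is log-convex because \<open>\<beta> \<le> 1\<close>.
\<close>

section \<open>Riemann--Liouville kernels\<close>

text \<open>
  The kernel of fractional integration of order \<open>a\<close>. It vanishes on the negative half-line, so that
  convolutions over \<open>(0,t)\<close> can be written as integrals over the whole line.
\<close>

definition riemann_liouville :: "real \<Rightarrow> real \<Rightarrow> real" where
  "riemann_liouville a t = (if t > 0 then t powr (a - 1) / Gamma a else 0)"

lemma riemann_liouville_nonneg: "a > 0 \<Longrightarrow> riemann_liouville a t \<ge> 0"
  by (simp add: riemann_liouville_def Gamma_real_pos less_imp_le)

lemma borel_measurable_riemann_liouville [measurable]: "riemann_liouville a \<in> borel_measurable borel"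
  unfolding riemann_liouville_def[abs_def] by measurable

lemma nn_integral_riemann_liouville_exp:
  assumes "a > 0" "s > 0"
  shows "(\<integral>\<^sup>+t. ennreal (riemann_liouville a t * exp (- (s * t))) \<partial>lborel) = ennreal (s powr (- a))"
proof -
  note [simp] = Gamma_real_pos[OF assms(1)]
  have "(\<integral>\<^sup>+t. ennreal (riemann_liouville a t * exp (- (s * t))) \<partial>lborel) =
        ennreal \<bar>1 / s\<bar> * (\<integral>\<^sup>+t. ennreal (riemann_liouville a (0 + 1 / s * t) * exp (- (s * (0 + 1 / s * t)))) \<partial>lborel)"
    by (rule nn_integral_real_affine) (use assms in auto)
  also have "\<dots> = ennreal \<bar>1 / s\<bar> * (\<integral>\<^sup>+t. ennreal (s powr (1 - a) / Gamma a) *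
      ennreal (indicator {0..} t * t powr (a - 1) / exp t) \<partial>lborel)"
  proof (intro arg_cong[where f = "\<lambda>x. _ * x"] nn_integral_cong)
    fix t :: real
    have "t powr (a - 1) = s powr (a - 1) * (t / s) powr (a - 1)" if "t > 0"
      using assms that by (simp flip: powr_mult)
    moreover have "s powr (1 - a) * s powr (a - 1) = 1"
      using assms by (simp flip: powr_add)
    ultimately have "riemann_liouville a (t / s) * exp (- t) =
          s powr (1 - a) / Gamma a * (indicator {0..} t * t powr (a - 1) / exp t)"
      using assms by (cases "t = 0") (auto simp: riemann_liouville_def indicator_def exp_minus field_simps)
    then show "ennreal (riemann_liouville a (0 + 1 / s * t) * exp (- (s * (0 + 1 / s * t)))) =
       ennreal (s powr (1 - a) / Gamma a) * ennreal (indicator {0..} t * t powr (a - 1) / exp t)"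
      using assms by (subst ennreal_mult[symmetric]) (auto simp: indicator_def less_imp_le)
  qed
  also have "\<dots> = ennreal \<bar>1 / s\<bar> * (ennreal (s powr (1 - a) / Gamma a) * ennreal (Gamma a))"
    using assms by (subst nn_integral_cmult) (auto simp: Gamma_conv_nn_integral_real)
  also have "\<dots> = ennreal (1 / s * (s powr (1 - a) / Gamma a * Gamma a))"
    using assms by (simp only: ennreal_mult[symmetric] abs_of_pos divide_pos_pos zero_less_one)
      (simp flip: ennreal_mult add: less_imp_le)
  also have "1 / s * (s powr (1 - a) / Gamma a * Gamma a) = s powr (- a)"
    using assms less_imp_neq[OF Gamma_real_pos[OF assms(1)]]
    by (simp add: powr_diff powr_minus field_simps)
  finally show ?thesis .
qed

text \<open>
  The semigroup property of fractional integration. After the substitution \<open>u = t * v\<close> it is the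
  formula of Euler's Beta integral.
\<close>

lemma riemann_liouville_convolution:
  assumes "a > 0" "b > 0"
  shows "has_bochner_integral lborel (\<lambda>u. riemann_liouville a (t - u) * riemann_liouville b u)
           (riemann_liouville (a + b) t)"
proof (cases "t > 0")
  case False
  then have "(\<lambda>u. riemann_liouville a (t - u) * riemann_liouville b u) = (\<lambda>u. 0)"
    by (auto simp: riemann_liouville_def fun_eq_iff)
  moreover have "riemann_liouville (a + b) t = 0"
    using False by (simp add: riemann_liouville_def)
  ultimately show ?thesis by (simp add: has_bochner_integral_zero)
next
  case True
  note pos = Gamma_real_pos[OF assms(1)] Gamma_real_pos[OF assms(2)]
  have "(\<integral>\<^sup>+u. ennreal (riemann_liouville a (t - u) * riemann_liouville b u) \<partial>lborel) =
      ennreal \<bar>t\<bar> * (\<integral>\<^sup>+v. ennreal (riemann_liouville a (t - (0 + t * v)) * riemann_liouville b (0 + t * v)) \<partial>lborel)"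
    by (rule nn_integral_real_affine) (use True in auto)
  also have "\<dots> = ennreal \<bar>t\<bar> * (\<integral>\<^sup>+v. ennreal (t powr (a + b - 2) / (Gamma a * Gamma b)) *
      ennreal (indicator {0..1} v * (v powr (b - 1) * (1 - v) powr (a - 1))) \<partial>lborel)"
  proof (intro arg_cong[where f = "\<lambda>x. _ * x"] nn_integral_cong)
    fix v :: real
    have *: "t - t * v = t * (1 - v)" by (simp add: algebra_simps)
    have "riemann_liouville a (t - t * v) * riemann_liouville b (t * v) =
       t powr (a + b - 2) / (Gamma a * Gamma b) * (indicator {0..1} v * (v powr (b - 1) * (1 - v) powr (a - 1)))"
    proof (cases "v \<in> {0<..<1}")
      case True
      have "t powr (a + b - 2) = t powr (a - 1) * t powr (b - 1)"
        by (simp flip: powr_add)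
      then show ?thesis unfolding *
        using True \<open>t > 0\<close> by (simp add: riemann_liouville_def powr_mult zero_less_mult_iff)
    next
      case False
      then show ?thesis unfolding *
        using \<open>t > 0\<close> by (cases "v = 0 \<or> v = 1")
          (auto simp: riemann_liouville_def zero_less_mult_iff indicator_def)
    qed
    then show "ennreal (riemann_liouville a (t - (0 + t * v)) * riemann_liouville b (0 + t * v)) =
       ennreal (t powr (a + b - 2) / (Gamma a * Gamma b)) *
       ennreal (indicator {0..1} v * (v powr (b - 1) * (1 - v) powr (a - 1)))"
      using pos by (subst ennreal_mult[symmetric]) (auto simp: less_imp_le)
  qed
  also have "\<dots> = ennreal \<bar>t\<bar> * (ennreal (t powr (a + b - 2) / (Gamma a * Gamma b)) * ennreal (Beta b a))"
    using has_integral_Beta_real[OF assms(2,1)]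
    by (subst nn_integral_cmult) (auto simp: nn_integral_has_integral_lebesgue)
  also have "\<dots> = ennreal (t * (t powr (a + b - 2) / (Gamma a * Gamma b) * Beta b a))"
  proof -
    have "0 \<le> t powr (a + b - 2) / (Gamma a * Gamma b)" "0 \<le> Beta b a" "0 \<le> t"
      using assms True pos by (auto simp: Beta_def Gamma_real_pos less_imp_le)
    then show ?thesis
      by (simp only: abs_of_nonneg ennreal_mult mult_nonneg_nonneg)
  qed
  also have "t * (t powr (a + b - 2) / (Gamma a * Gamma b) * Beta b a) = riemann_liouville (a + b) t"
  proof -
    have "t powr (a + b - 1) = t * t powr (a + b - 2)"
      using True by (simp add: powr_mult_base)
    then show ?thesis
      using True pos by (simp add: riemann_liouville_def Beta_def add.commute)
  qed
  finally show ?thesis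
    using assms by (intro has_bochner_integral_nn_integral)
      (auto intro!: AE_I2 mult_nonneg_nonneg riemann_liouville_nonneg)
qed

text \<open>
  Restricting Euler's integral to \<open>[R, R + 1]\<close> shows that \<open>Gamma\<close> outgrows every exponential; this
  suffices for the convergence of all the Mittag-Leffler type series below.
\<close>

lemma Gamma_ge_power:
  assumes "x \<ge> 1" "R > (0::real)"
  shows "R powr (x - 1) * exp (- (R + 1)) \<le> Gamma x"
proof -
  have "ennreal (R powr (x - 1) * exp (- (R + 1))) =
      (\<integral>\<^sup>+t. ennreal (R powr (x - 1) * exp (- (R + 1))) * indicator {R..R+1} t \<partial>lborel)"
    by (simp add: nn_integral_cmult_indicator)
  also have "\<dots> \<le> (\<integral>\<^sup>+t. ennreal (indicator {0..} t * t powr (x - 1) / exp t) \<partial>lborel)"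
  proof (rule nn_integral_mono)
    fix t :: real
    have "R powr (x - 1) * exp (- (R + 1)) \<le> t powr (x - 1) * exp (- t)" if "t \<in> {R..R+1}"
      using that assms by (intro mult_mono powr_mono2) auto
    then show "ennreal (R powr (x - 1) * exp (- (R + 1))) * indicator {R..R+1} t
        \<le> ennreal (indicator {0..} t * t powr (x - 1) / exp t)"
      using assms by (auto simp: indicator_def exp_minus divide_inverse)
  qed
  also have "\<dots> = ennreal (Gamma x)"
    using assms by (simp add: Gamma_conv_nn_integral_real)
  finally show ?thesis
    using assms by (subst (asm) ennreal_le_iff) (auto simp: Gamma_real_pos less_imp_le)
qed

lemma summable_power_over_Gamma:
  assumes "\<beta> > 0" "b > 0"
  shows "summable (\<lambda>n. (z::real) ^ n / Gamma (\<beta> * real n + b))"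
proof -
  \<comment> \<open>chosen such that \<open>\<bar>z\<bar> / R powr \<beta> \<le> 1 / 2\<close>, so that a geometric series dominates\<close>
  define R where "R = (2 * (\<bar>z\<bar> + 1)) powr (1 / \<beta>)"
  have R: "R > 0" "R powr \<beta> = 2 * (\<bar>z\<bar> + 1)"
    using assms by (auto simp: R_def powr_powr)
  define C where "C = exp (R + 1) * R powr (1 - b)"
  obtain N :: nat where N: "real N \<ge> 1 / \<beta>" using real_arch_simple by blast
  show ?thesis
  proof (rule summable_comparison_test', rule summable_mult)
    show "summable (\<lambda>n. (1 / 2 :: real) ^ n)" by (simp add: summable_geometric)
    fix n assume n: "n \<ge> N"
    have "\<beta> * real n \<ge> \<beta> * (1 / \<beta>)"
      using N n assms by (intro mult_left_mono) linarith+
    then have *: "\<beta> * real n + b \<ge> 1" using assms by simp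
    have "R powr (\<beta> * real n + b - 1) = R powr (\<beta> * real n) / R powr (1 - b)"
      by (simp flip: powr_diff add: algebra_simps)
    also have "R powr (\<beta> * real n) = (R powr \<beta>) ^ n"
      using R(1) by (simp add: powr_powr powr_realpow[symmetric])
    finally have "R powr (\<beta> * real n + b - 1) * exp (- (R + 1)) = (R powr \<beta>) ^ n / C"
      by (simp only: C_def exp_minus) (simp add: field_simps)
    then have le: "(R powr \<beta>) ^ n / C \<le> Gamma (\<beta> * real n + b)"
      using Gamma_ge_power[OF * R(1)] by simp
    have "norm (z ^ n / Gamma (\<beta> * real n + b)) = \<bar>z\<bar> ^ n / Gamma (\<beta> * real n + b)"
      using * by (simp add: abs_mult power_abs Gamma_real_pos)
    also have "\<dots> \<le> \<bar>z\<bar> ^ n / ((R powr \<beta>) ^ n / C)"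
      using le R by (intro divide_left_mono) (auto simp: C_def intro!: mult_pos_pos divide_pos_pos Gamma_real_pos order.strict_trans2[OF _ *])
    also have "\<dots> = C * (\<bar>z\<bar> / (2 * (\<bar>z\<bar> + 1))) ^ n"
      by (simp add: R power_divide)
    also have "\<dots> \<le> C * (1 / 2) ^ n"
      using R by (intro mult_left_mono power_mono) (auto simp: C_def divide_simps)
    finally show "norm (z ^ n / Gamma (\<beta> * real n + b)) \<le> C * (1 / 2) ^ n" .
  qed
qed

section \<open>The Mittag-Leffler density as an alternating series of kernels\<close>

text \<open>
  The density of Mittag-Leffler relaxation, as a series that is meaningful on the whole line: it
  coincides with \<open>mittag_leffler_density\<close> for \<open>t > 0\<close> and vanishes otherwise.
\<close>

definition relaxation_density :: "real \<Rightarrow> real \<Rightarrow> real" where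
  "relaxation_density \<beta> t = (\<Sum>n. (- 1) ^ n * riemann_liouville (\<beta> * real (Suc n)) t)"

lemma relaxation_density_nonpos [simp]: "t \<le> 0 \<Longrightarrow> relaxation_density \<beta> t = 0"
  by (simp add: relaxation_density_def riemann_liouville_def)

lemma borel_measurable_relaxation_density [measurable]:
  "relaxation_density \<beta> \<in> borel_measurable borel"
  unfolding relaxation_density_def[abs_def] by measurable

lemma riemann_liouville_term:
  assumes "t > 0"
  shows "riemann_liouville (\<beta> * real (Suc n)) t =
           t powr (\<beta> - 1) * ((t powr \<beta>) ^ n / Gamma (\<beta> * real n + \<beta>))"
proof -
  have "t powr (\<beta> * real (Suc n) - 1) = t powr (\<beta> - 1) * (t powr (\<beta> * real n))"
    by (simp flip: powr_add add: algebra_simps)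
  also have "t powr (\<beta> * real n) = (t powr \<beta>) ^ n"
    using assms by (simp add: powr_powr powr_realpow[symmetric])
  finally show ?thesis
    using assms by (simp add: riemann_liouville_def algebra_simps)
qed

lemma summable_riemann_liouville:
  assumes "\<beta> > 0"
  shows "summable (\<lambda>n. riemann_liouville (\<beta> * real (Suc n)) t)"
proof (cases "t > 0")
  case True
  then show ?thesis
    unfolding riemann_liouville_term[OF True]
    using assms by (intro summable_mult summable_power_over_Gamma)
qed (simp add: riemann_liouville_def)

lemma summable_alternating_riemann_liouville:
  assumes "\<beta> > 0"
  shows "summable (\<lambda>n. (- 1) ^ n * riemann_liouville (\<beta> * real (Suc n)) t)"
  using summable_riemann_liouville[OF assms, of t]
  by (rule summable_comparison_test'[where N = 0])
     (use assms in \<open>simp add: abs_mult riemann_liouville_nonneg power_abs\<close>)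

text \<open>
  The entire function \<open>E\<^sub>\<beta>\<^sub>,\<^sub>\<beta> (- z)\<close>, where \<open>E\<^sub>\<beta>\<^sub>,\<^sub>\<beta>\<close> is the two-parameter Mittag-Leffler function. The
  density is \<open>t powr (\<beta> - 1) * E\<^sub>\<beta>\<^sub>,\<^sub>\<beta> (- (t powr \<beta>))\<close>, and inherits continuity from this power series.
\<close>

definition relaxation_series :: "real \<Rightarrow> real \<Rightarrow> real" where
  "relaxation_series \<beta> z = (\<Sum>n. (- 1) ^ n / Gamma (\<beta> * real n + \<beta>) * z ^ n)"

lemma summable_alternating_power_over_Gamma:
  assumes "\<beta> > 0" "b > 0"
  shows "summable (\<lambda>n. (- 1) ^ n / Gamma (\<beta> * real n + b) * z ^ n)"
  using summable_power_over_Gamma[OF assms, of "- z"]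
  by (simp add: power_minus[of z] mult.commute)

lemma relaxation_density_eq:
  assumes "\<beta> > 0" "t > 0"
  shows "relaxation_density \<beta> t = t powr (\<beta> - 1) * relaxation_series \<beta> (t powr \<beta>)"
  unfolding relaxation_density_def relaxation_series_def riemann_liouville_term[OF assms(2)]
  using suminf_mult[OF summable_alternating_power_over_Gamma[OF assms(1,1)], of "t powr (\<beta> - 1)" "t powr \<beta>"]
  by (simp add: mult_ac)

lemma isCont_relaxation_series:
  assumes "\<beta> > 0"
  shows "isCont (relaxation_series \<beta>) z"
  unfolding relaxation_series_def[abs_def]
  by (rule DERIV_isCont[OF termdiffs_strong_converges_everywhere])
     (rule summable_alternating_power_over_Gamma[OF assms assms])

lemma continuous_on_relaxation_density:
  assumes "\<beta> > 0"
  shows "continuous_on {0<..} (relaxation_density \<beta>)"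
proof -
  have "isCont (\<lambda>t. t powr (\<beta> - 1) * relaxation_series \<beta> (t powr \<beta>)) t" if "t > 0" for t
    using that by (intro continuous_mult isCont_o2[OF _ isCont_relaxation_series[OF assms]])
      (auto intro!: continuous_at_within_powr continuous_const continuous_ident)
  then have "continuous_on {0<..} (\<lambda>t. t powr (\<beta> - 1) * relaxation_series \<beta> (t powr \<beta>))"
    by (simp add: continuous_at_imp_continuous_on)
  then show ?thesis
    by (rule continuous_on_eq) (use assms in \<open>simp add: relaxation_density_eq\<close>)
qed

text \<open>
  Termwise differentiation turns the coefficient \<open>(n + 1) / Gamma (1 + \<beta> * (n + 1))\<close> into
  \<open>1 / (\<beta> * Gamma (\<beta> * (n + 1)))\<close> by the functional equation of \<open>Gamma\<close>; the factor \<open>1 / \<beta>\<close>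
  cancels against the derivative of \<open>t powr \<beta>\<close>.
\<close>

lemma mittag_leffler_density_eq:
  assumes "\<beta> > 0" "t > 0"
  shows "mittag_leffler_density \<beta> t = relaxation_density \<beta> t"
proof -
  define c :: "nat \<Rightarrow> real" where "c n = (- 1) ^ n / Gamma (\<beta> * real n + 1)" for n
  have E: "mittag_leffler \<beta> (- z) = (\<Sum>n. c n * z ^ n)" for z :: real
    by (simp add: mittag_leffler_def c_def power_minus[of z] add.commute mult.commute)
  have "diffs c n = - ((- 1) ^ n / Gamma (\<beta> * real n + \<beta>)) / \<beta>" for n
  proof -
    have "0 < \<beta> * real n + \<beta>" using assms by (simp add: add_nonneg_pos)
    then have "\<beta> * real n + \<beta> \<notin> \<int>\<^sub>\<le>\<^sub>0" using nonpos_Ints_nonpos by fastforce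
    then have "Gamma (1 + (\<beta> * real n + \<beta>)) = (\<beta> * real n + \<beta>) * Gamma (\<beta> * real n + \<beta>)"
      using assms Gamma_plus1[of "\<beta> * real n + \<beta>"]
      by (simp add: add.commute)
    moreover have "\<beta> * real n + \<beta> = \<beta> * real (Suc n)" by (simp add: algebra_simps)
    ultimately show ?thesis
      using assms by (simp add: diffs_def c_def add.commute)
  qed
  then have Q: "(\<Sum>n. diffs c n * z ^ n) = - relaxation_series \<beta> z / \<beta>" for z
    using suminf_mult[OF summable_alternating_power_over_Gamma[OF assms(1,1)], of "- 1 / \<beta>" z]
    by (simp add: relaxation_series_def mult_ac)
  have D: "((\<lambda>z. mittag_leffler \<beta> (- z)) has_field_derivative (- relaxation_series \<beta> z / \<beta>)) (at z)" for z
    unfolding E Q[symmetric]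
    by (rule termdiffs_strong_converges_everywhere)
       (use assms in \<open>simp only: c_def, intro summable_alternating_power_over_Gamma, auto\<close>)
  have "((\<lambda>u. mittag_leffler \<beta> (- (u powr \<beta>))) has_field_derivative
      (- relaxation_series \<beta> (t powr \<beta>) / \<beta>) * (\<beta> * t powr (\<beta> - 1))) (at t)"
    by (rule DERIV_chain2[OF D]) (use assms in \<open>auto intro!: has_real_derivative_powr\<close>)
  from DERIV_imp_deriv[OF this] show ?thesis
    using assms by (simp add: mittag_leffler_density_def relaxation_density_eq mult_ac)
qed

text \<open>
  The renewal equation of the density. Convolution with the kernel of order \<open>\<beta>\<close> shifts the
  alternating series by one term, which removes its first term and changes the sign of the rest.
\<close>

lemma relaxation_density_renewal:
  assumes "\<beta> > 0"
  shows "has_bochner_integral lborel (\<lambda>u. riemann_liouville \<beta> (t - u) * relaxation_density \<beta> u)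
           (riemann_liouville \<beta> t - relaxation_density \<beta> t)"
proof -
  let ?k = "\<lambda>n. riemann_liouville (\<beta> * real (Suc n))"
  define f where "f n u = riemann_liouville \<beta> (t - u) * ((- 1) ^ n * ?k n u)" for n :: nat and u
  have conv: "has_bochner_integral lborel (\<lambda>u. riemann_liouville \<beta> (t - u) * ?k n u) (?k (Suc n) t)" for n
  proof -
    have "\<beta> * real (Suc (Suc n)) = \<beta> + \<beta> * real (Suc n)" by (simp add: algebra_simps)
    then show ?thesis
      using riemann_liouville_convolution[of \<beta> "\<beta> * real (Suc n)" t] assms by simp
  qed
  have int_f: "has_bochner_integral lborel (f n) ((- 1) ^ n * ?k (Suc n) t)" for n
  proof -
    have "f n = (\<lambda>u. (- 1) ^ n * (riemann_liouville \<beta> (t - u) * ?k n u))"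
      by (simp add: f_def fun_eq_iff)
    then show ?thesis
      using has_bochner_integral_mult_right[OF conv, of "(- 1) ^ n" n] by (simp only:)
  qed
  have norm_f: "norm (f n u) = riemann_liouville \<beta> (t - u) * ?k n u" for n u
    using assms by (simp add: f_def abs_mult power_abs riemann_liouville_nonneg)
  have sums: "(\<Sum>n. f n u) = riemann_liouville \<beta> (t - u) * relaxation_density \<beta> u" for u
    unfolding f_def relaxation_density_def
    by (rule suminf_mult) (rule summable_alternating_riemann_liouville[OF assms])
  have 1: "integrable lborel (f n)" for n
    using int_f by (rule integrable.intros)
  have 2: "AE u in lborel. summable (\<lambda>n. norm (f n u))"
    unfolding norm_f by (intro AE_I2 summable_mult summable_riemann_liouville assms)
  have 3: "summable (\<lambda>n. \<integral>u. norm (f n u) \<partial>lborel)"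
    unfolding norm_f has_bochner_integral_integral_eq[OF conv]
    by (subst summable_Suc_iff) (rule summable_riemann_liouville[OF assms])
  have "(\<integral>u. (\<Sum>n. f n u) \<partial>lborel) = (\<Sum>n. (- 1) ^ n * ?k (Suc n) t)"
    unfolding integral_suminf[OF 1 2 3] has_bochner_integral_integral_eq[OF int_f] ..
  also have "\<dots> = - (\<Sum>n. (- 1) ^ Suc n * ?k (Suc n) t)"
  proof -
    have "summable (\<lambda>n. (- 1) ^ Suc n * ?k (Suc n) t)"
      by (subst summable_Suc_iff) (rule summable_alternating_riemann_liouville[OF assms])
    from suminf_minus[OF this] show ?thesis by simp
  qed
  also have "\<dots> = riemann_liouville \<beta> t - relaxation_density \<beta> t"
    unfolding relaxation_density_def
    by (subst suminf_split_head[OF summable_alternating_riemann_liouville[OF assms]]) simp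
  finally show ?thesis
    using integrable_suminf[OF 1 2 3] unfolding sums by (simp add: has_bochner_integral_iff)
qed

section \<open>Positivity and Laplace transform of the density\<close>

text \<open>
  Near the origin the leading kernel of the alternating series dominates.
\<close>

lemma eventually_relaxation_density_pos:
  assumes "\<beta> > 0"
  shows "\<forall>\<^sub>F t in at_right 0. relaxation_density \<beta> t > 0"
proof -
  have lim: "((\<lambda>t::real. t powr \<beta>) \<longlongrightarrow> 0) (at_right 0)"
    using assms by real_asymp
  have "((\<lambda>t. relaxation_series \<beta> (t powr \<beta>)) \<longlongrightarrow> relaxation_series \<beta> 0) (at_right 0)"
    by (rule isCont_tendsto_compose[OF isCont_relaxation_series[OF assms] lim])
  moreover have "relaxation_series \<beta> 0 = 1 / Gamma \<beta>"
    unfolding relaxation_series_def by (subst powser_zero) simp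
  then have "relaxation_series \<beta> 0 > 0"
    using assms by (simp add: Gamma_real_pos)
  ultimately have "\<forall>\<^sub>F t in at_right 0. relaxation_series \<beta> (t powr \<beta>) > 0"
    by (rule order_tendstoD(1))
  moreover have "\<forall>\<^sub>F t::real in at_right 0. t > 0"
    by (rule eventually_at_right_less)
  ultimately show ?thesis
    by eventually_elim (simp add: relaxation_density_eq assms)
qed

text \<open>
  Log-convexity of the kernel, in the form needed below: the ratio of its values at \<open>x + (t - s)\<close> and
  \<open>x\<close> increases with \<open>x\<close>, so among \<open>x = s - u\<close> it is largest for \<open>u = 0\<close>.
\<close>

lemma riemann_liouville_shift_le:
  assumes "0 < \<beta>" "\<beta> \<le> 1" "0 \<le> u" "u < s" "s \<le> t"
  shows "riemann_liouville \<beta> (t - u) \<le>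
           riemann_liouville \<beta> t / riemann_liouville \<beta> s * riemann_liouville \<beta> (s - u)"
proof -
  have "(s - u) / (t - u) \<le> s / t"
    using assms mult_right_mono[of s t u] by (simp add: field_simps)
  then have "((s - u) / (t - u)) powr (1 - \<beta>) \<le> (s / t) powr (1 - \<beta>)"
    using assms by (intro powr_mono2) auto
  moreover have "x powr (1 - \<beta>) = 1 / x powr (\<beta> - 1)" if "x > 0" for x :: real
    using that by (simp add: powr_diff field_simps)
  ultimately have "(t - u) powr (\<beta> - 1) / (s - u) powr (\<beta> - 1) \<le> t powr (\<beta> - 1) / s powr (\<beta> - 1)"
    using assms by (simp add: powr_divide)
  then have "(t - u) powr (\<beta> - 1) \<le> t powr (\<beta> - 1) / s powr (\<beta> - 1) * (s - u) powr (\<beta> - 1)"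
    using assms by (simp add: pos_divide_le_eq)
  then show ?thesis
    using assms Gamma_real_pos[OF assms(1)]
    by (simp add: riemann_liouville_def pos_divide_le_eq) (use Gamma_real_pos[OF assms(1)] in linarith)
qed

text \<open>
  Up to a shift this is convolution with the kernel of order 1, which is the Heaviside function.
\<close>

lemma integral_riemann_liouville_initial:
  assumes "0 < \<beta>" "0 \<le> d"
  shows "has_bochner_integral lborel (\<lambda>u. riemann_liouville \<beta> (t - u) * indicator {t-d<..} u)
           (d powr \<beta> / Gamma (\<beta> + 1))"
proof (cases "d = 0")
  case True
  then have "(\<lambda>u. riemann_liouville \<beta> (t - u) * indicator {t-d<..} u) = (\<lambda>u. 0)"
    by (auto simp: riemann_liouville_def indicator_def fun_eq_iff)
  with True show ?thesis by (simp add: has_bochner_integral_zero)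
next
  case False
  have "has_bochner_integral lborel (\<lambda>u. riemann_liouville \<beta> (d - u) * riemann_liouville 1 u)
      (riemann_liouville (\<beta> + 1) d)"
    using assms by (intro riemann_liouville_convolution) auto
  then have "has_bochner_integral lborel
     (\<lambda>u. riemann_liouville \<beta> (d - (d - t + 1 * u)) * riemann_liouville 1 (d - t + 1 * u))
     (riemann_liouville (\<beta> + 1) d /\<^sub>R \<bar>1\<bar>)"
    by (subst lborel_has_bochner_integral_real_affine_iff[symmetric]) simp_all
  moreover have "riemann_liouville 1 (d - t + 1 * u) = indicator {t-d<..} u" for u
    by (auto simp: riemann_liouville_def indicator_def)
  moreover have "riemann_liouville (\<beta> + 1) d = d powr \<beta> / Gamma (\<beta> + 1)"
    using False assms by (simp add: riemann_liouville_def)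
  ultimately show ?thesis by simp
qed

text \<open>
  Suppose that \<open>t0\<close> is the first point at which the density \<open>g\<close> fails to be positive, and let \<open>g\<close>
  attain its maximum over a short interval \<open>[t0 - d, t0]\<close> at \<open>s\<close>. Compare the renewal equations at
  \<open>t0\<close> and at \<open>s\<close>. On \<open>(0, s)\<close>, log-convexity bounds the integral for \<open>t0\<close> by that for \<open>s\<close>
  times \<open>q = k t0 / k s\<close>; on \<open>(s, t0)\<close>, where \<open>g \<le> g s\<close>, the integral is at most \<open>g s\<close> times a quantity that
  vanishes with \<open>d\<close>. In total \<open>g t0\<close> is at least \<open>g s\<close> times something positive, since \<open>q\<close> is close
  to 1 for small \<open>d\<close>.
\<close>

lemma relaxation_density_pos:
  assumes \<beta>: "0 < \<beta>" "\<beta> \<le> 1" and "t > 0"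
  shows "relaxation_density \<beta> t > 0"
proof (rule ccontr)
  let ?g = "relaxation_density \<beta>" and ?k = "riemann_liouville \<beta>"
  assume neg: "\<not> ?g t > 0"
  define Z where "Z = {x. x > 0 \<and> ?g x \<le> 0}"
  define t0 where "t0 = Inf Z"
  have Z: "t \<in> Z" "bdd_below Z"
    using neg \<open>t > 0\<close> by (auto simp: Z_def intro!: bdd_belowI[of _ 0])
  obtain e where e: "e > 0" "\<And>x. 0 < x \<Longrightarrow> x < e \<Longrightarrow> ?g x > 0"
    using eventually_relaxation_density_pos[OF \<beta>(1)] by (auto simp: eventually_at_right_field)
  have "t0 \<ge> e"
    unfolding t0_def by (rule cInf_greatest) (use Z e in \<open>force simp: Z_def\<close>)+
  then have "t0 > 0" using e by simp
  have before: "?g x > 0" if "0 < x" "x < t0" for x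
    using that cInf_lower[OF _ Z(2), of x] by (force simp: Z_def t0_def)
  have "?g t0 \<le> 0"
  proof (rule ccontr)
    assume "\<not> ?g t0 \<le> 0"
    moreover have "(?g \<longlongrightarrow> ?g t0) (at t0)"
      using continuous_on_relaxation_density[OF \<beta>(1)] \<open>t0 > 0\<close>
      by (auto simp: continuous_on_eq_continuous_at isCont_def)
    ultimately have "\<forall>\<^sub>F x in at t0. ?g x > 0"
      by (intro order_tendstoD(1)) auto
    then obtain r where r: "r > 0" "\<And>x. x \<noteq> t0 \<Longrightarrow> dist x t0 < r \<Longrightarrow> ?g x > 0"
      unfolding eventually_at by blast
    have "x \<ge> t0 + r" if "x \<in> Z" for x
    proof (rule ccontr)
      assume "\<not> x \<ge> t0 + r"
      then have "?g x > 0"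
        using r(2)[of x] before[of x] that \<open>\<not> ?g t0 \<le> 0\<close>
        by (cases "x = t0"; cases "x < t0") (auto simp: Z_def dist_real_def)
      with that show False by (simp add: Z_def)
    qed
    then have "t0 + r \<le> t0"
      unfolding t0_def by (intro cInf_greatest) (use Z in auto)
    with r show False by simp
  qed

  \<comment> \<open>the left-hand side is the integral of the kernel over \<open>(0, d)\<close>, the right-hand side a lower bound for \<open>q\<close>\<close>
  have "\<forall>\<^sub>F d in at_right 0. d powr \<beta> / Gamma (\<beta> + 1) < t0 powr (\<beta> - 1) / (t0 - d) powr (\<beta> - 1)"
  proof -
    have "((\<lambda>d. t0 powr (\<beta> - 1) / (t0 - d) powr (\<beta> - 1) - d powr \<beta> / Gamma (\<beta> + 1)) \<longlongrightarrow>
        t0 powr (\<beta> - 1) / (t0 - 0) powr (\<beta> - 1) - 0 / Gamma (\<beta> + 1)) (at_right 0)"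
    proof (intro tendsto_intros)
      show "((\<lambda>d. d powr \<beta>) \<longlongrightarrow> 0) (at_right 0)" using \<beta> by real_asymp
      show "Gamma (\<beta> + 1) \<noteq> 0" using Gamma_real_pos[of "\<beta> + 1"] \<beta> by linarith
    qed (use \<open>t0 > 0\<close> in auto)
    from order_tendstoD(1)[OF this, of 0] show ?thesis
      using \<open>t0 > 0\<close> by simp
  qed
  moreover have "\<forall>\<^sub>F d in at_right 0. d < t0"
    using \<open>t0 > 0\<close> by (auto simp: eventually_at_right_field)
  moreover have "\<forall>\<^sub>F d::real in at_right 0. d > 0"
    by (rule eventually_at_right_less)
  ultimately have "\<forall>\<^sub>F d in at_right 0. 0 < d \<and> d < t0 \<and>
      d powr \<beta> / Gamma (\<beta> + 1) < t0 powr (\<beta> - 1) / (t0 - d) powr (\<beta> - 1)"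
    by eventually_elim auto
  from eventually_happens'[OF trivial_limit_at_right_real this] obtain d where d: "0 < d" "d < t0"
      "d powr \<beta> / Gamma (\<beta> + 1) < t0 powr (\<beta> - 1) / (t0 - d) powr (\<beta> - 1)"
    by blast

  have "continuous_on {t0 - d..t0} ?g"
    by (rule continuous_on_subset[OF continuous_on_relaxation_density[OF \<beta>(1)]]) (use d in auto)
  then have "\<exists>s\<in>{t0 - d..t0}. \<forall>x\<in>{t0 - d..t0}. ?g x \<le> ?g s"
    using d by (intro continuous_attains_sup) auto
  then obtain s where s: "s \<in> {t0 - d..t0}" "\<And>x. x \<in> {t0 - d..t0} \<Longrightarrow> ?g x \<le> ?g s"
    by blast
  have "?g s > 0"
    using s(2)[of "t0 - d"] before[of "t0 - d"] d by simp
  with s(1) \<open>?g t0 \<le> 0\<close> d have s': "0 < s" "s < t0" "t0 - s \<le> d"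
    by (auto simp: less_le)
  define q where "q = ?k t0 / ?k s"
  have ks: "?k s > 0" "?k t0 > 0"
    using s' \<open>t0 > 0\<close> \<beta> by (auto simp: riemann_liouville_def Gamma_real_pos)

  have lhs: "has_bochner_integral lborel (\<lambda>u. ?k (t0 - u) * ?g u) (?k t0 - ?g t0)"
    by (rule relaxation_density_renewal[OF \<beta>(1)])
  have rhs: "has_bochner_integral lborel
       (\<lambda>u. q * (?k (s - u) * ?g u) + ?g s * (?k (t0 - u) * indicator {t0 - (t0 - s)<..} u))
       (q * (?k s - ?g s) + ?g s * ((t0 - s) powr \<beta> / Gamma (\<beta> + 1)))"
    by (intro has_bochner_integral_add has_bochner_integral_mult_right
          relaxation_density_renewal integral_riemann_liouville_initial) (use \<beta> s' in auto)
  have le: "?k (t0 - u) * ?g u \<le>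
        q * (?k (s - u) * ?g u) + ?g s * (?k (t0 - u) * indicator {t0 - (t0 - s)<..} u)"
    if "u \<noteq> s" for u
  proof -
    consider "u \<le> 0" | "0 < u" "u < s" | "s < u" "u < t0" | "t0 \<le> u"
      using \<open>u \<noteq> s\<close> by linarith
    then show ?thesis
    proof cases
      case 1
      then show ?thesis
        using \<open>?g s > 0\<close> by (simp add: riemann_liouville_nonneg \<beta>)
    next
      case 2
      then have "?k (t0 - u) * ?g u \<le> (q * ?k (s - u)) * ?g u"
        unfolding q_def using \<beta> s' before[of u]
        by (intro mult_right_mono riemann_liouville_shift_le) auto
      with 2 show ?thesis by (simp add: mult.assoc)
    next
      case 3
      then have "?k (t0 - u) * ?g u \<le> ?k (t0 - u) * ?g s"
        using s \<beta> by (intro mult_left_mono riemann_liouville_nonneg s(2)) auto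
      with 3 show ?thesis by (simp add: riemann_liouville_def mult.commute)
    next
      case 4
      with s' show ?thesis by (simp add: riemann_liouville_def)
    qed
  qed
  \<comment> \<open>at \<open>u = s\<close> both terms of the majorant vanish, so the comparison holds only almost everywhere\<close>
  have "AE u in lborel. ?k (t0 - u) * ?g u \<le>
        q * (?k (s - u) * ?g u) + ?g s * (?k (t0 - u) * indicator {t0 - (t0 - s)<..} u)"
    using AE_lborel_singleton[of s] by eventually_elim (rule le)
  then have "?k t0 - ?g t0 \<le> q * (?k s - ?g s) + ?g s * ((t0 - s) powr \<beta> / Gamma (\<beta> + 1))"
    using integral_mono_AE[OF integrable.intros[OF lhs] integrable.intros[OF rhs]]
    by (simp only: has_bochner_integral_integral_eq[OF lhs] has_bochner_integral_integral_eq[OF rhs])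
  moreover have "q * ?k s = ?k t0"
    using ks by (simp add: q_def)
  ultimately have "?g s * q \<le> ?g s * ((t0 - s) powr \<beta> / Gamma (\<beta> + 1))"
    using \<open>?g t0 \<le> 0\<close> by (simp add: algebra_simps)
  then have "q \<le> (t0 - s) powr \<beta> / Gamma (\<beta> + 1)"
    using \<open>?g s > 0\<close> by (simp only: mult_le_cancel_left_pos)
  also have "\<dots> \<le> d powr \<beta> / Gamma (\<beta> + 1)"
    using s' \<beta> by (intro divide_right_mono powr_mono2) (auto simp: less_imp_le Gamma_real_pos)
  also have "\<dots> < t0 powr (\<beta> - 1) / (t0 - d) powr (\<beta> - 1)"
    by (rule d)
  also have "\<dots> \<le> t0 powr (\<beta> - 1) / s powr (\<beta> - 1)"
    using d s' \<beta> by (intro divide_left_mono powr_mono2') auto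
  also have "\<dots> = q"
    using s' \<open>t0 > 0\<close> Gamma_real_pos[OF \<beta>(1)] by (simp add: q_def riemann_liouville_def)
  finally show False by simp
qed

text \<open>
  Multiplication by \<open>exp (- (s * t))\<close> is compatible with convolution, so the renewal equation passes
  to \<open>h\<close> and \<open>l\<close>, the exponentially damped density and kernel. Working with extended nonnegative
  integrals, the integrability of \<open>h\<close> need not be known in advance but follows from that of \<open>l\<close>.
\<close>

lemma nn_integral_relaxation_density_exp:
  assumes \<beta>: "0 < \<beta>" "\<beta> \<le> 1" and "s > 0"
  shows "(\<integral>\<^sup>+t. ennreal (relaxation_density \<beta> t * exp (- (s * t))) \<partial>lborel) = ennreal (1 / (1 + s powr \<beta>))"
proof -
  let ?g = "relaxation_density \<beta>" and ?k = "riemann_liouville \<beta>"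
  define h where "h t = ?g t * exp (- (s * t))" for t
  define l where "l t = ?k t * exp (- (s * t))" for t
  have [measurable]: "h \<in> borel_measurable borel" "l \<in> borel_measurable borel"
    unfolding h_def[abs_def] l_def[abs_def] by measurable
  have g: "?g t \<ge> 0" for t
    using relaxation_density_pos[OF \<beta>, of t] by (cases "t > 0") auto
  have nn: "h t \<ge> 0" "l t \<ge> 0" for t
    using g[of t] \<beta> by (auto simp: h_def l_def riemann_liouville_nonneg)
  define G where "G = (\<integral>\<^sup>+t. ennreal (h t) \<partial>lborel)"
  have L: "(\<integral>\<^sup>+t. ennreal (l t) \<partial>lborel) = ennreal (s powr (- \<beta>))"
    unfolding l_def by (rule nn_integral_riemann_liouville_exp) fact+
  have renewal: "ennreal (l t) = ennreal (h t) + (\<integral>\<^sup>+u. ennreal (l (t - u)) * ennreal (h u) \<partial>lborel)" for t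
  proof -
    have "has_bochner_integral lborel (\<lambda>u. exp (- (s * t)) * (?k (t - u) * ?g u)) (exp (- (s * t)) * (?k t - ?g t))"
      by (intro has_bochner_integral_mult_right relaxation_density_renewal \<beta>)
    moreover have "exp (- (s * t)) * (?k (t - u) * ?g u) = l (t - u) * h u" for u
      by (simp add: l_def h_def algebra_simps flip: exp_add)
    moreover have "exp (- (s * t)) * (?k t - ?g t) = l t - h t"
      by (simp add: l_def h_def algebra_simps)
    ultimately have hb: "has_bochner_integral lborel (\<lambda>u. l (t - u) * h u) (l t - h t)"
      by simp
    then have "0 \<le> l t - h t"
      using nn by (subst has_bochner_integral_integral_eq[OF hb, symmetric]) simp
    moreover have "(\<integral>\<^sup>+u. ennreal (l (t - u) * h u) \<partial>lborel) = ennreal (l t - h t)"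
      using nn_integral_eq_integral[OF integrable.intros[OF hb]] nn
      by (simp add: has_bochner_integral_integral_eq[OF hb])
    ultimately show ?thesis
      using nn by (simp add: ennreal_mult flip: ennreal_plus)
  qed
  have "ennreal (s powr (- \<beta>)) = G + (\<integral>\<^sup>+t. (\<integral>\<^sup>+u. ennreal (l (t - u)) * ennreal (h u) \<partial>lborel) \<partial>lborel)"
    unfolding L[symmetric] G_def by (subst renewal, rule nn_integral_add) measurable
  also have "(\<integral>\<^sup>+t. (\<integral>\<^sup>+u. ennreal (l (t - u)) * ennreal (h u) \<partial>lborel) \<partial>lborel) =
      (\<integral>\<^sup>+u. (\<integral>\<^sup>+t. ennreal (l (t - u)) * ennreal (h u) \<partial>lborel) \<partial>lborel)"
    by (rule lborel_pair.Fubini') measurable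
  also have "\<dots> = (\<integral>\<^sup>+u. ennreal (s powr (- \<beta>)) * ennreal (h u) \<partial>lborel)"
  proof (rule nn_integral_cong)
    fix u
    have "(\<integral>\<^sup>+t. ennreal (l t) \<partial>lborel) = ennreal \<bar>1\<bar> * (\<integral>\<^sup>+t. ennreal (l (- u + 1 * t)) \<partial>lborel)"
      by (rule nn_integral_real_affine) auto
    then show "(\<integral>\<^sup>+t. ennreal (l (t - u)) * ennreal (h u) \<partial>lborel) = ennreal (s powr (- \<beta>)) * ennreal (h u)"
      by (simp add: nn_integral_multc L)
  qed
  also have "\<dots> = ennreal (s powr (- \<beta>)) * G"
    by (simp add: nn_integral_cmult G_def)
  finally have eq: "ennreal (s powr (- \<beta>)) = G + ennreal (s powr (- \<beta>)) * G" .
  then have "G \<noteq> \<infinity>" by (auto simp: ennreal_top_mult)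
  then obtain r where r: "r \<ge> 0" "G = ennreal r" by (cases G) auto
  have "s powr (- \<beta>) = r + s powr (- \<beta>) * r"
    using eq r by (simp flip: ennreal_mult ennreal_plus)
  then have "r = 1 / (1 + s powr \<beta>)"
  proof -
    have "r * (1 + s powr \<beta>) = 1"
      using \<open>s powr (- \<beta>) = _\<close> \<open>s > 0\<close> by (simp add: powr_minus field_simps)
    moreover have "1 + s powr \<beta> > 0" by (simp add: add_pos_nonneg)
    ultimately show ?thesis by (simp add: field_simps)
  qed
  with r show ?thesis by (simp add: G_def h_def)
qed

lemma has_laplace_transform_mittag_leffler_density:
  assumes \<beta>: "0 < \<beta>" "\<beta> \<le> 1" and "s > 0"
  shows "has_laplace_transform (mittag_leffler_density \<beta>) s (1 / (1 + s powr \<beta>))"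
proof -
  have g: "relaxation_density \<beta> t \<ge> 0" for t
    using relaxation_density_pos[OF \<beta>, of t] by (cases "t > 0") auto
  \<comment> \<open>the value of \<open>mittag_leffler_density\<close> at 0 is the derivative at a point where it need not exist\<close>
  have ae: "AE t in lborel. relaxation_density \<beta> t * exp (- (s * t)) =
      (if t = 0 then mittag_leffler_density \<beta> 0 else relaxation_density \<beta> t * exp (- (s * t)))"
    using AE_lborel_singleton[of 0] by eventually_elim simp
  have "has_bochner_integral lborel (\<lambda>t. relaxation_density \<beta> t * exp (- (s * t))) (1 / (1 + s powr \<beta>))"
    using nn_integral_relaxation_density_exp[OF assms] g
    by (intro has_bochner_integral_nn_integral) auto
  then have "has_bochner_integral lborel
      (\<lambda>t. if t = 0 then mittag_leffler_density \<beta> 0 else relaxation_density \<beta> t * exp (- (s * t)))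
      (1 / (1 + s powr \<beta>))"
    by (rule has_bochner_integralI_AE[OF _ _ ae]) (auto intro!: measurable_If)
  also have "(\<lambda>t. if t = 0 then mittag_leffler_density \<beta> 0 else relaxation_density \<beta> t * exp (- (s * t))) =
      (\<lambda>t. indicator {0..} t *\<^sub>R (mittag_leffler_density \<beta> t * exp (- (s * t))))"
    using mittag_leffler_density_eq[OF \<beta>(1)] by (auto simp: fun_eq_iff indicator_def not_le)
  finally show ?thesis
    by (simp add: has_laplace_transform_def set_integrable_def set_lebesgue_integral_def has_bochner_integral_iff)
qed

section \<open>Laplace--Stieltjes transform near the origin\<close>

context
  fixes \<Phi> :: "real \<Rightarrow> real"
  assumes distr: "waiting_time_distribution \<Phi>"
begin

interpretation real_distribution "stieltjes_measure \<Phi>"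
  by (rule real_distribution_stieltjes_measure[OF distr])

lemma AE_stieltjes_measure_pos: "AE t in stieltjes_measure \<Phi>. t > 0"
proof -
  have "measure (stieltjes_measure \<Phi>) {..0} = 0"
    using cdf_stieltjes_measure[OF distr, of 0] distr
    by (simp add: cdf_def waiting_time_distribution_def)
  then show ?thesis
    by (intro AE_I[of _ _ "{..0}"]) (auto simp: emeasure_eq_measure not_less)
qed

lemma measure_stieltjes_tail:
  assumes "x \<ge> 0"
  shows "measure (stieltjes_measure \<Phi>) {x<..} = 1 - \<Phi> x"
proof -
  have "measure (stieltjes_measure \<Phi>) (space (stieltjes_measure \<Phi>) - {..x}) = 1 - \<Phi> x"
    using cdf_stieltjes_measure[OF distr, of x] assms by (subst prob_compl) (auto simp: cdf_def)
  moreover have "space (stieltjes_measure \<Phi>) - {..x} = {x<..}" by auto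
  ultimately show ?thesis by simp
qed

lemma laplace_stieltjes_eq: "laplace_stieltjes \<Phi> s = (\<integral>t. exp (- (s * t)) \<partial>stieltjes_measure \<Phi>)"
  unfolding laplace_stieltjes_def set_lebesgue_integral_def
  by (rule integral_cong_AE) (use AE_stieltjes_measure_pos in \<open>auto elim!: eventually_mono\<close>)

lemma integrable_exp_stieltjes:
  assumes "s \<ge> 0"
  shows "integrable (stieltjes_measure \<Phi>) (\<lambda>t. exp (- (s * t)))"
  by (rule integrable_const_bound[where B = 1])
     (use AE_stieltjes_measure_pos assms in \<open>auto elim!: eventually_mono\<close>)

text \<open>
  Integration by parts, already rescaled by \<open>y = s * t\<close>: write \<open>1 - exp (- (s * t))\<close> as the integral
  of \<open>exp (- y)\<close> over \<open>[0, s * t)\<close> and exchange the two integrations.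
\<close>

lemma one_minus_laplace_stieltjes:
  assumes "s > 0"
  shows "has_bochner_integral lborel (\<lambda>y. indicator {0..} y * (exp (- y) * (1 - \<Phi> (y / s))))
           (1 - laplace_stieltjes \<Phi> s)"
proof -
  let ?M = "stieltjes_measure \<Phi>"
  have exp_int: "(\<integral>\<^sup>+y. ennreal (exp (- y)) * indicator {0..<s * t} y \<partial>lborel) = ennreal (1 - exp (- (s * t)))"
    if "t > 0" for t
  proof -
    have "(\<integral>\<^sup>+y. ennreal (exp (- y)) * indicator {0..<s * t} y \<partial>lborel) =
        (\<integral>\<^sup>+y. ennreal (exp (- y)) * indicator {0..s * t} y \<partial>lborel)"
      by (rule nn_integral_cong_AE)
         (auto intro!: eventually_mono[OF AE_lborel_singleton[of "s * t"]] simp: indicator_def)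
    also have "\<dots> = ennreal (- exp (- (s * t)) - - exp (- 0))"
      by (rule nn_integral_FTC_Icc) (use assms that in \<open>auto intro!: derivative_eq_intros\<close>)
    finally show ?thesis by simp
  qed
  have bnd: "AE t in ?M. 0 \<le> 1 - exp (- (s * t))"
    using AE_stieltjes_measure_pos by eventually_elim (use assms in auto)
  have int: "integrable ?M (\<lambda>t. 1 - exp (- (s * t)))"
    using integrable_exp_stieltjes[of s] assms by auto
  have val: "(\<integral>t. 1 - exp (- (s * t)) \<partial>?M) = 1 - laplace_stieltjes \<Phi> s"
    using integrable_exp_stieltjes[of s] assms prob_space by (simp add: laplace_stieltjes_eq)
  have "ennreal (1 - laplace_stieltjes \<Phi> s) = (\<integral>\<^sup>+t. ennreal (1 - exp (- (s * t))) \<partial>?M)"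
    using nn_integral_eq_integral[OF int bnd] val by simp
  also have "\<dots> = (\<integral>\<^sup>+t. (\<integral>\<^sup>+y. ennreal (exp (- y)) * indicator {0..<s * t} y \<partial>lborel) \<partial>?M)"
    using AE_stieltjes_measure_pos by (intro nn_integral_cong_AE) (auto elim!: eventually_mono simp: exp_int)
  also have "\<dots> = (\<integral>\<^sup>+y. (\<integral>\<^sup>+t. ennreal (exp (- y)) * indicator {0..<s * t} y \<partial>?M) \<partial>lborel)"
  proof -
    interpret pair_sigma_finite lborel ?M ..
    have "ennreal (exp (- y)) * indicator {0..<s * t} y =
        (if 0 \<le> y \<and> y < s * t then ennreal (exp (- y)) else 0)" for y t
      by simp
    moreover have "(\<lambda>(y, t). if 0 \<le> y \<and> y < s * t then ennreal (exp (- y)) else 0)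
        \<in> borel_measurable (lborel \<Otimes>\<^sub>M ?M)"
      by measurable
    ultimately show ?thesis
      using Fubini'[of "\<lambda>y t. ennreal (exp (- y)) * indicator {0..<s * t} y"] by simp
  qed
  also have "\<dots> = (\<integral>\<^sup>+y. ennreal (indicator {0..} y * (exp (- y) * (1 - \<Phi> (y / s)))) \<partial>lborel)"
  proof (rule nn_integral_cong)
    fix y :: real
    show "(\<integral>\<^sup>+t. ennreal (exp (- y)) * indicator {0..<s * t} y \<partial>?M) =
        ennreal (indicator {0..} y * (exp (- y) * (1 - \<Phi> (y / s))))"
    proof (cases "y \<ge> 0")
      case True
      have "(\<integral>\<^sup>+t. ennreal (exp (- y)) * indicator {0..<s * t} y \<partial>?M) =
          (\<integral>\<^sup>+t. ennreal (exp (- y)) * indicator {y / s<..} t \<partial>?M)"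
        by (intro nn_integral_cong) (use True assms in \<open>auto simp: indicator_def field_simps\<close>)
      also have "\<dots> = ennreal (exp (- y)) * ennreal (1 - \<Phi> (y / s))"
        using measure_stieltjes_tail[of "y / s"] True assms
        by (simp add: nn_integral_cmult_indicator emeasure_eq_measure)
      finally show ?thesis
        using True by (simp add: ennreal_mult')
    qed auto
  qed
  finally have *: "(\<integral>\<^sup>+y. ennreal (indicator {0..} y * (exp (- y) * (1 - \<Phi> (y / s)))) \<partial>lborel) =
      ennreal (1 - laplace_stieltjes \<Phi> s)" ..
  have "(\<lambda>y. indicator {0..} y * (exp (- y) * (1 - \<Phi> (y / s)))) =
      (\<lambda>y. indicator {0..} y * (exp (- y) * (1 - cdf ?M (y / s))))"
    using assms by (auto simp: cdf_stieltjes_measure[OF distr] indicator_def fun_eq_iff)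
  moreover have "cdf ?M \<in> borel_measurable borel"
    by (rule borel_measurable_mono) (simp add: mono_def cdf_nondecreasing)
  ultimately have meas: "(\<lambda>y. indicator {0..} y * (exp (- y) * (1 - \<Phi> (y / s)))) \<in> borel_measurable borel"
    by simp
  have "1 - laplace_stieltjes \<Phi> s \<ge> 0"
    unfolding val[symmetric] by (rule integral_nonneg_AE) (rule bnd)
  moreover have "\<Phi> (y / s) \<le> 1" if "y \<ge> 0" for y
    using that assms distr by (auto simp: waiting_time_distribution_def Pi_def)
  ultimately show ?thesis
    using meas * by (intro has_bochner_integral_nn_integral) (auto simp: indicator_def)
qed

lemma laplace_stieltjes_tendsto_1: "(laplace_stieltjes \<Phi> \<longlongrightarrow> 1) (at_right 0)"
  unfolding filterlim_at_right_to_top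
proof -
  have "((\<lambda>x. \<integral>t. exp (- (inverse x * t)) \<partial>stieltjes_measure \<Phi>) \<longlongrightarrow> (\<integral>t. 1 \<partial>stieltjes_measure \<Phi>)) at_top"
  proof (rule integral_dominated_convergence_at_top[where w = "\<lambda>_. 1"])
    show "\<forall>\<^sub>F x in at_top. AE t in stieltjes_measure \<Phi>. norm (exp (- (inverse x * t))) \<le> 1"
      using eventually_gt_at_top[of 0] 
      by eventually_elim (use AE_stieltjes_measure_pos in \<open>auto elim!: eventually_mono\<close>)
    have "((\<lambda>x::real. exp (- (inverse x * t))) \<longlongrightarrow> 1) at_top" for t
      by real_asymp
    then show "AE t in stieltjes_measure \<Phi>. ((\<lambda>x::real. exp (- (inverse x * t))) \<longlongrightarrow> 1) at_top"
      by simp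
  qed auto
  then show "((\<lambda>x. laplace_stieltjes \<Phi> (inverse x)) \<longlongrightarrow> 1) at_top"
    using prob_space by (simp add: laplace_stieltjes_eq)
qed

text \<open>
  Dominated convergence: \<open>(1 - exp (- (s * t))) / s\<close> lies between 0 and its limit \<open>t\<close>.
\<close>

lemma laplace_stieltjes_finite_mean:
  assumes "set_integrable (stieltjes_measure \<Phi>) {0..} (\<lambda>t. t)"
  shows "((\<lambda>s. (1 - laplace_stieltjes \<Phi> s) / s) \<longlongrightarrow> (LINT t:{0..}|stieltjes_measure \<Phi>. t)) (at_right 0)"
    and "(LINT t:{0..}|stieltjes_measure \<Phi>. t) > 0"
proof -
  let ?M = "stieltjes_measure \<Phi>"
  have eq: "AE t in ?M. indicator {0..} t *\<^sub>R t = t"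
    using AE_stieltjes_measure_pos by eventually_elim auto
  have int: "integrable ?M (\<lambda>t. t)"
    using assms eq unfolding set_integrable_def by (subst integrable_cong_AE[symmetric]) auto
  have mean: "(LINT t:{0..}|?M. t) = (\<integral>t. t \<partial>?M)"
    unfolding set_lebesgue_integral_def by (rule integral_cong_AE) (use eq in auto)
  have "((\<lambda>x. \<integral>t. x * (1 - exp (- (inverse x * t))) \<partial>?M) \<longlongrightarrow> (\<integral>t. t \<partial>?M)) at_top"
  proof (rule integral_dominated_convergence_at_top[where w = "\<lambda>t. t"])
    show "\<forall>\<^sub>F x in at_top. AE t in ?M. norm (x * (1 - exp (- (inverse x * t)))) \<le> t"
      using eventually_gt_at_top[of 0]
    proof eventually_elim
      case (elim x)
      show ?case
        using AE_stieltjes_measure_pos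
      proof eventually_elim
        case (elim t)
        have "1 - exp (- (inverse x * t)) \<le> inverse x * t"
          using exp_ge_add_one_self[of "- (inverse x * t)"] by linarith
        then have "x * (1 - exp (- (inverse x * t))) \<le> x * (inverse x * t)"
          using \<open>0 < x\<close> by (intro mult_left_mono) auto
        also have "x * (inverse x * t) = t"
          using \<open>0 < x\<close> by simp
        finally show ?case
          using \<open>0 < x\<close> elim by simp
      qed
    qed
    have "((\<lambda>x::real. x * (1 - exp (- (inverse x * t)))) \<longlongrightarrow> t) at_top" for t
      by real_asymp
    then show "AE t in ?M. ((\<lambda>x::real. x * (1 - exp (- (inverse x * t)))) \<longlongrightarrow> t) at_top"
      by simp
  next
    show "integrable ?M (\<lambda>t. t)" by (rule int)
  qed auto
  moreover have "\<forall>\<^sub>F x in at_top. (\<integral>t. x * (1 - exp (- (inverse x * t))) \<partial>?M) =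
      (1 - laplace_stieltjes \<Phi> (inverse x)) / inverse x"
    using eventually_gt_at_top[of 0]
  proof eventually_elim
    case (elim x)
    have "(\<integral>t. x * (1 - exp (- (inverse x * t))) \<partial>?M) = x * (\<integral>t. 1 - exp (- (inverse x * t)) \<partial>?M)"
      by (rule integral_mult_right_zero)
    also have "(\<integral>t. 1 - exp (- (inverse x * t)) \<partial>?M) = 1 - laplace_stieltjes \<Phi> (inverse x)"
      using integrable_exp_stieltjes[of "inverse x"] elim prob_space
      by (subst Bochner_Integration.integral_diff) (simp_all add: laplace_stieltjes_eq)
    finally show ?case
      by (simp only: divide_inverse inverse_inverse_eq mult.commute[of x])
  qed
  ultimately show "((\<lambda>s. (1 - laplace_stieltjes \<Phi> s) / s) \<longlongrightarrow> (LINT t:{0..}|?M. t)) (at_right 0)"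
    unfolding filterlim_at_right_to_top mean by (rule Lim_transform_eventually)
  have "(\<integral>t. t \<partial>?M) > 0"
    using AE_stieltjes_measure_pos int by (intro expectation_greater) auto
  then show "(LINT t:{0..}|?M. t) > 0" by (simp add: mean)
qed

text \<open>
  The tail estimate holds only near infinity, but it extends to a bound \<open>1 - \<Phi> x \<le> K * x powr (- \<beta>)\<close>
  for all \<open>x > 0\<close>, because \<open>1 - \<Phi>\<close> is bounded by 1. Since \<open>\<beta> < 1\<close>, the resulting majorant
  \<open>K * y powr (- \<beta>) * exp (- y)\<close> is integrable at 0, and dominated convergence applies.
\<close>

lemma laplace_stieltjes_regular_tail:
  assumes \<beta>: "0 < \<beta>" "\<beta> < 1" and "c > 0"
    and tail: "(\<lambda>t. 1 - \<Phi> t) \<sim>[at_top] (\<lambda>t. c / \<beta> * t powr (- \<beta>))"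
  shows "((\<lambda>s. (1 - laplace_stieltjes \<Phi> s) / s powr \<beta>) \<longlongrightarrow> c / \<beta> * Gamma (1 - \<beta>)) (at_right 0)"
proof -
  let ?w = "\<lambda>y. indicator {0..} y * (y powr ((1 - \<beta>) - 1) / exp y)"
  have lim: "((\<lambda>x. x powr \<beta> * (1 - \<Phi> x)) \<longlongrightarrow> c / \<beta>) at_top"
  proof -
    have "((\<lambda>x. (1 - \<Phi> x) / (c / \<beta> * x powr (- \<beta>))) \<longlongrightarrow> 1) at_top"
    proof (rule asymp_equivD_strong[OF tail])
      show "\<forall>\<^sub>F x in at_top. 1 - \<Phi> x \<noteq> 0 \<or> c / \<beta> * x powr - \<beta> \<noteq> 0"
        using eventually_gt_at_top[of 0] by eventually_elim (use \<open>c > 0\<close> \<beta> in simp)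
    qed
    then have "((\<lambda>x. c / \<beta> * ((1 - \<Phi> x) / (c / \<beta> * x powr (- \<beta>)))) \<longlongrightarrow> c / \<beta> * 1) at_top"
      by (intro tendsto_intros)
    moreover have "c / \<beta> * ((1 - \<Phi> x) / (c / \<beta> * x powr (- \<beta>))) = x powr \<beta> * (1 - \<Phi> x)" for x
      using \<open>c > 0\<close> \<beta> by (simp add: powr_minus field_simps)
    ultimately show ?thesis by simp
  qed
  have bounds: "0 \<le> \<Phi> x" "\<Phi> x \<le> 1" if "x \<ge> 0" for x
    using that distr by (auto simp: waiting_time_distribution_def Pi_def)
  obtain K where K: "K > 0" "\<And>x. x \<ge> 0 \<Longrightarrow> x powr \<beta> * (1 - \<Phi> x) \<le> K"
  proof -
    have "\<forall>\<^sub>F x in at_top. x powr \<beta> * (1 - \<Phi> x) < c / \<beta> + 1"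
      by (rule order_tendstoD(2)[OF lim]) simp
    then obtain N where N: "\<And>x. x \<ge> N \<Longrightarrow> x powr \<beta> * (1 - \<Phi> x) < c / \<beta> + 1"
      by (auto simp: eventually_at_top_linorder)
    define K where "K = max (c / \<beta> + 1) (\<bar>N\<bar> powr \<beta>)"
    have "x powr \<beta> * (1 - \<Phi> x) \<le> K" if "x \<ge> 0" for x
    proof (cases "x \<ge> N")
      case False
      have "x powr \<beta> * (1 - \<Phi> x) \<le> \<bar>N\<bar> powr \<beta> * 1"
        using False that \<beta> bounds[of x] by (intro mult_mono powr_mono2) auto
      then show ?thesis by (simp add: K_def)
    qed (use N[of x] in \<open>simp add: K_def\<close>)
    moreover have "K > 0" using \<open>c > 0\<close> \<beta> by (simp add: K_def less_max_iff_disj add_pos_pos)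
    ultimately show ?thesis using that by blast
  qed
  \<comment> \<open>the integrand of lemma \<open>one_minus_laplace_stieltjes\<close> for \<open>s = inverse x\<close>, divided by \<open>s powr \<beta>\<close>\<close>
  define G where "G x y = x powr \<beta> * (indicator {0..} y * (exp (- y) * (1 - \<Phi> (y / inverse x))))" for x y
  have hb: "has_bochner_integral lborel (G x) ((1 - laplace_stieltjes \<Phi> (inverse x)) / inverse x powr \<beta>)"
    if "x > 0" for x
  proof -
    have "(1 - laplace_stieltjes \<Phi> (inverse x)) / inverse x powr \<beta> =
        x powr \<beta> * (1 - laplace_stieltjes \<Phi> (inverse x))"
    proof -
      have "x powr \<beta> * inverse x powr \<beta> = 1"
        using that by (simp flip: powr_mult)
      from inverse_unique[OF this] have "inverse x powr \<beta> = inverse (x powr \<beta>)" ..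
      then show ?thesis by (simp add: divide_inverse mult.commute)
    qed
    then show ?thesis
      unfolding G_def[abs_def]
      using has_bochner_integral_mult_right[OF one_minus_laplace_stieltjes[of "inverse x"], of "x powr \<beta>"] that
      by simp
  qed
  have w: "has_bochner_integral lborel ?w (Gamma (1 - \<beta>))"
    using Gamma_conv_nn_integral_real[of "1 - \<beta>"] \<beta>
    by (intro has_bochner_integral_nn_integral) (auto simp: Gamma_real_pos less_imp_le)
  have "((\<lambda>x. \<integral>y. (if x > 0 then G x y else 0) \<partial>lborel) \<longlongrightarrow> (\<integral>y. c / \<beta> * ?w y \<partial>lborel)) at_top"
  proof (rule integral_dominated_convergence_at_top[where w = "\<lambda>y. K * ?w y"])
    fix x
    show "(\<lambda>y. if x > 0 then G x y else 0) \<in> borel_measurable lborel"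
      using borel_measurable_has_bochner_integral[OF hb, of x] by (cases "x > 0") auto
  next
    have G_eq: "G x y = ((y * x) powr \<beta> * (1 - \<Phi> (y * x))) * ?w y" if "x > 0" "y \<noteq> 0" for x y
      using that by (cases "y > 0") (auto simp: G_def exp_minus powr_mult powr_minus field_simps)
    show "\<forall>\<^sub>F x in at_top. AE y in lborel. norm (if x > 0 then G x y else 0) \<le> K * ?w y"
      using eventually_gt_at_top[of 0]
    proof eventually_elim
      case (elim x)
      show ?case
        using AE_lborel_singleton[of 0]
      proof eventually_elim
        case (elim y)
        show ?case
        proof (cases "y > 0")
          case True
          then show ?thesis
            using \<open>x > 0\<close> K(2)[of "y * x"] bounds[of "y * x"]
            by (auto simp: G_eq abs_mult intro!: divide_right_mono mult_right_mono)
        qed (use elim in \<open>simp add: G_def\<close>)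
      qed
    qed
    show "AE y in lborel. ((\<lambda>x. if x > 0 then G x y else 0) \<longlongrightarrow> c / \<beta> * ?w y) at_top"
      using AE_lborel_singleton[of 0]
    proof eventually_elim
      case (elim y)
      show ?case
      proof (cases "y > 0")
        case True
        have "filterlim (\<lambda>x. y * x) at_top at_top"
          using True by real_asymp
        from filterlim_compose[OF lim this]
        have "((\<lambda>x. ((y * x) powr \<beta> * (1 - \<Phi> (y * x))) * ?w y) \<longlongrightarrow> c / \<beta> * ?w y) at_top"
          by (intro tendsto_mult tendsto_const)
        moreover have "\<forall>\<^sub>F x in at_top. ((y * x) powr \<beta> * (1 - \<Phi> (y * x))) * ?w y = (if x > 0 then G x y else 0)"
          using eventually_gt_at_top[of 0] by eventually_elim (use elim in \<open>simp add: G_eq\<close>)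
        ultimately show ?thesis by (rule Lim_transform_eventually)
      next
        case False
        then have "(\<lambda>x. if x > 0 then G x y else 0) = (\<lambda>x. 0)" and "?w y = 0"
          using elim by (auto simp: G_def fun_eq_iff)
        then show ?thesis by (simp only: mult_zero_right tendsto_const)
      qed
    qed
  next
    show "integrable lborel (\<lambda>y. K * ?w y)"
      by (rule integrable_mult_right[OF integrable.intros[OF w]])
  qed measurable
  then have "((\<lambda>x. \<integral>y. (if x > 0 then G x y else 0) \<partial>lborel) \<longlongrightarrow> c / \<beta> * Gamma (1 - \<beta>)) at_top"
    unfolding has_bochner_integral_integral_eq[OF has_bochner_integral_mult_right[OF w]] .
  moreover have "\<forall>\<^sub>F x in at_top. (\<integral>y. (if x > 0 then G x y else 0) \<partial>lborel) =
      (1 - laplace_stieltjes \<Phi> (inverse x)) / inverse x powr \<beta>"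
    using eventually_gt_at_top[of 0]
    by eventually_elim (simp add: has_bochner_integral_integral_eq[OF hb])
  ultimately show ?thesis
    unfolding filterlim_at_right_to_top by (rule Lim_transform_eventually)
qed

end

lemma respeed_rescale_tendsto:
  assumes lim1: "(f \<longlongrightarrow> 1) (at_right 0)"
    and lim: "((\<lambda>s. (1 - f s) / s powr \<beta>) \<longlongrightarrow> lam) (at_right 0)"
    and "lam > 0" "s > 0"
  shows "((\<lambda>\<tau>. respeed (lam * \<tau> powr \<beta>) (rescale \<tau> f) s) \<longlongrightarrow> 1 / (1 + s powr \<beta>)) (at_right 0)"
proof -
  have scale: "filterlim (\<lambda>\<tau>. \<tau> * s) (at_right 0) (at_right 0)"
    using \<open>s > 0\<close> by real_asymp
  define q where "q \<tau> = (1 - f (\<tau> * s)) / (\<tau> * s) powr \<beta>" for \<tau>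
  have q: "(q \<longlongrightarrow> lam) (at_right 0)"
    unfolding q_def by (rule filterlim_compose[OF lim scale])
  have f: "((\<lambda>\<tau>. f (\<tau> * s)) \<longlongrightarrow> 1) (at_right 0)"
    by (rule filterlim_compose[OF lim1 scale])
  have "((\<lambda>\<tau>. lam * f (\<tau> * s) / (q \<tau> * s powr \<beta> + lam * f (\<tau> * s))) \<longlongrightarrow>
      lam * 1 / (lam * s powr \<beta> + lam * 1)) (at_right 0)"
  proof (intro tendsto_intros q f)
    have "lam * s powr \<beta> + lam * 1 > 0"
      using \<open>lam > 0\<close> by (intro add_nonneg_pos) auto
    then show "lam * s powr \<beta> + lam * 1 \<noteq> 0" by simp
  qed
  also have "lam * 1 / (lam * s powr \<beta> + lam * 1) = 1 / (1 + s powr \<beta>)"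
  proof -
    have "lam * s powr \<beta> + lam * 1 = lam * (1 + s powr \<beta>)" by (simp add: algebra_simps)
    then show ?thesis using \<open>lam > 0\<close> by simp
  qed
  finally have "((\<lambda>\<tau>. lam * f (\<tau> * s) / (q \<tau> * s powr \<beta> + lam * f (\<tau> * s))) \<longlongrightarrow>
      1 / (1 + s powr \<beta>)) (at_right 0)" .
  moreover have "\<forall>\<^sub>F \<tau> in at_right 0. lam * f (\<tau> * s) / (q \<tau> * s powr \<beta> + lam * f (\<tau> * s)) =
      respeed (lam * \<tau> powr \<beta>) (rescale \<tau> f) s"
    using eventually_at_right_less[of 0]
  proof eventually_elim
    case (elim \<tau>)
    have "\<tau> powr \<beta> * (q \<tau> * s powr \<beta>) = 1 - f (\<tau> * s)"
      using elim \<open>s > 0\<close> by (simp add: q_def powr_mult)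
    then have "\<tau> powr \<beta> * (q \<tau> * s powr \<beta> + lam * f (\<tau> * s)) =
        1 - (1 - lam * \<tau> powr \<beta>) * f (\<tau> * s)"
      by (simp add: algebra_simps)
    then have "respeed (lam * \<tau> powr \<beta>) (rescale \<tau> f) s =
        (\<tau> powr \<beta> * (lam * f (\<tau> * s))) / (\<tau> powr \<beta> * (q \<tau> * s powr \<beta> + lam * f (\<tau> * s)))"
      by (simp add: respeed_def rescale_def mult_ac)
    then show ?case using elim by simp
  qed
  ultimately show ?thesis by (rule Lim_transform_eventually)
qed

lemma Gamma_reflection_real:
  fixes x :: real
  shows "Gamma x * Gamma (1 - x) = pi / sin (pi * x)"
proof -
  have "complex_of_real (Gamma x * Gamma (1 - x)) = complex_of_real (pi / sin (pi * x))"
    using Gamma_reflection_complex[of "complex_of_real x"]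
    by (simp flip: Gamma_complex_of_real sin_of_real)
  then show ?thesis by (simp only: of_real_eq_iff)
qed

theorem mainTheorem1:
  fixes \<Phi> :: "real \<Rightarrow> real" and \<beta> lam :: real
  assumes distr: "waiting_time_distribution \<Phi>"
    and tail:
      "(set_integrable (stieltjes_measure \<Phi>) {0..} (\<lambda>t. t) \<and>
        \<beta> = 1 \<and> lam = (LINT t:{0..}|stieltjes_measure \<Phi>. t))
       \<or>
       (0 < \<beta> \<and> \<beta> < 1 \<and>
        (\<exists>c>0. (\<lambda>t. 1 - \<Phi> t) \<sim>[at_top] (\<lambda>t. c / \<beta> * t powr (- \<beta>)) \<and>
               lam = c * pi / (Gamma (\<beta> + 1) * sin (\<beta> * pi))))"
  shows "\<forall>s>0.
     ((\<lambda>\<tau>. respeed (lam * \<tau> powr \<beta>) (rescale \<tau> (laplace_stieltjes \<Phi>)) s)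
        \<longlongrightarrow> 1 / (1 + s powr \<beta>)) (at_right 0) \<and>
     has_laplace_transform (mittag_leffler_density \<beta>) s (1 / (1 + s powr \<beta>))"
proof -
  have "0 < \<beta> \<and> \<beta> \<le> 1 \<and> lam > 0 \<and>
      ((\<lambda>s. (1 - laplace_stieltjes \<Phi> s) / s powr \<beta>) \<longlongrightarrow> lam) (at_right 0)"
    using tail
  proof (elim disjE conjE exE)
    assume int: "set_integrable (stieltjes_measure \<Phi>) {0..} (\<lambda>t. t)" and "\<beta> = 1"
      and lam: "lam = (LINT t:{0..}|stieltjes_measure \<Phi>. t)"
    have "\<forall>\<^sub>F s in at_right 0. (1 - laplace_stieltjes \<Phi> s) / s = (1 - laplace_stieltjes \<Phi> s) / s powr \<beta>"
      using eventually_at_right_less[of 0] by eventually_elim (simp add: \<open>\<beta> = 1\<close>)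
    with laplace_stieltjes_finite_mean(1)[OF distr int]
    have "((\<lambda>s. (1 - laplace_stieltjes \<Phi> s) / s powr \<beta>) \<longlongrightarrow> lam) (at_right 0)"
      unfolding lam by (rule Lim_transform_eventually)
    then show ?thesis
      using laplace_stieltjes_finite_mean(2)[OF distr int] \<open>\<beta> = 1\<close> by (simp add: lam)
  next
    fix c
    assume \<beta>: "0 < \<beta>" "\<beta> < 1" and "0 < c"
      and asymp: "(\<lambda>t. 1 - \<Phi> t) \<sim>[at_top] (\<lambda>t. c / \<beta> * t powr (- \<beta>))"
      and lam: "lam = c * pi / (Gamma (\<beta> + 1) * sin (\<beta> * pi))"
    have "Gamma (\<beta> + 1) = \<beta> * Gamma \<beta>"
      using \<beta> Gamma_plus1[of \<beta>] nonpos_Ints_nonpos[of \<beta>] by (auto simp: add.commute)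
    then have "lam = c / \<beta> * ((pi / sin (pi * \<beta>)) / Gamma \<beta>)"
      by (simp add: lam mult_ac)
    also have "(pi / sin (pi * \<beta>)) / Gamma \<beta> = Gamma (1 - \<beta>)"
      using Gamma_reflection_real[of \<beta>, symmetric] Gamma_real_pos[OF \<beta>(1)] by simp
    finally have "lam = c / \<beta> * Gamma (1 - \<beta>)" .
    then show ?thesis
      using \<beta> \<open>0 < c\<close> laplace_stieltjes_regular_tail[OF distr \<beta> \<open>0 < c\<close> asymp]
      by (simp add: Gamma_real_pos)
  qed
  then have \<beta>: "0 < \<beta>" "\<beta> \<le> 1" and "lam > 0"
    and lim: "((\<lambda>s. (1 - laplace_stieltjes \<Phi> s) / s powr \<beta>) \<longlongrightarrow> lam) (at_right 0)"
    by auto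
  show ?thesis
    by (intro allI impI conjI respeed_rescale_tendsto[OF laplace_stieltjes_tendsto_1[OF distr] lim \<open>lam > 0\<close>]
        has_laplace_transform_mittag_leffler_density[OF \<beta>])
qed

end
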